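(* Let $C$ be a nonempty closed convex subset of a real Hilbert space $H$. Let $T$ be a nonexpansive mapping of $C$ into itself such that $F(T)\ne\emptyset$. Assume $\{\alpha_n\}_{n\ge0}$ is a sequence in $(0,1)$ such that $\lim_{n\to\infty}\alpha_n=1$. Let $x_0\in C$ be arbitrary and define $\{x_n\}$ in $C$, for $n\ge0$, by $$y_n=(1-\alpha_n)x_0+\alpha_nTx_n,$$ $$C_n=\{z\in C:\|z-y_n\|^2\le\|z-x_n\|^2+(1-\alpha_n)(\|x_0\|^2+2\langle x_n-x_0,z\rangle)\},$$ $$Q_n=\{z\in C:\langle z-x_n,x_n-x_0\rangle\ge0\},$$ $$x_{n+1}=P_{C_n^*\cap Q_n}x_0,$$ where $C_n^*$ is a closed convex set with $F(T)\subset C_n^*\subset C_n$. Then $\{x_n\}$ converges strongly to $P_{F(T)}x_0$.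
   Context: $F(T)=\{x\in C:Tx=x\}$. $T$ is nonexpansive if $\|Tx-Ty\|\le\|x-y\|$ for all $x,y\in C$. For a nonempty closed convex set $D\subset H$, $P_D$ is the metric projection (nearest-point map) onto $D$. *)

theory Defs
  imports "HOL-Analysis.Analysis"
begin

definition fixed_points :: "'a set \<Rightarrow> ('a \<Rightarrow> 'a) \<Rightarrow> 'a set" where
  "fixed_points C T = {x \<in> C. T x = x}"

definition nonexpansive_on :: "'a::real_normed_vector set \<Rightarrow> ('a \<Rightarrow> 'a) \<Rightarrow> bool" where
  "nonexpansive_on C T \<longleftrightarrow> (\<forall>x\<in>C. \<forall>y\<in>C. norm (T x - T y) \<le> norm (x - y))"

(* The library's closest_point requires a heine_borel space, which would force
   finite dimension.  The value is unspecified unless D has exactly one point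
   nearest to a; nonempty closed convex subsets of a Hilbert space do. *)
definition metric_projection :: "'a::metric_space set \<Rightarrow> 'a \<Rightarrow> 'a" where
  "metric_projection D a = (THE p. p \<in> D \<and> (\<forall>q\<in>D. dist a p \<le> dist a q))"

end

theory Submission
  imports Defs
begin

text \<open>
  Write $A = I - T$ and $u = x_0$. Membership of $x_{n+1}$ in $Q_n$ makes the angle at $x_n$ in the
  triangle $u, x_n, x_{n+1}$ obtuse, so
  $\|x_{n+1}-x_n\|^2 \le \|x_{n+1}-u\|^2 - \|x_n-u\|^2$. By induction the sets $C_n^*\cap Q_n$ all
  contain $F(T)$, so the distances $\|x_n-u\|$ increase and stay below $\|q-u\|$ for every fixed
  point $q$. Hence the increments tend to $0$. Since $\alpha_n \to 1$, membership of $x_{n+1}$ in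
  $C_n$ then makes $\|x_{n+1}-y_n\|$ vanish, and so does $y_n - Tx_n = (1-\alpha_n)(u - Tx_n)$;
  together $Ax_n \to 0$.

  It remains to see that an approximate fixed point sequence that stays no further from $u$ than
  every fixed point converges to $P_{F(T)}u$ (lemma \<open>approximate_fixed_points_tendsto_projection\<close>).
  The classical argument extracts weakly convergent subsequences and uses demiclosedness of $A$.
  Here both are replaced by Browder's approximants, the solutions $z_k \in C$ of
  $u - z_k = k\,Az_k$. Monotonicity of $A$ shows that they form a Cauchy sequence, that the limit
  $p$ is a fixed point satisfying the variational inequality of $P_{F(T)}u$, and that
  $\langle u-z_k, x_n-z_k\rangle \le k\,\langle Ax_n, x_n-z_k\rangle$. Letting first $n$ and then
  $k$ grow gives $\limsup_n \langle u-p, x_n-p\rangle \le 0$, which together with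
  $\|x_n-u\| \le \|p-u\|$ forces $x_n \to p$.
\<close>

section \<open>Metric projections in Hilbert space\<close>

lemma obtuse_angle_norm_sq_le:
  fixes a p q :: "'a::real_inner"
  assumes "inner (q - p) (p - a) \<ge> 0"
  shows "(norm (q - p))\<^sup>2 + (norm (p - a))\<^sup>2 \<le> (norm (q - a))\<^sup>2"
proof -
  have "(norm (q - a))\<^sup>2 = (norm (q - p))\<^sup>2 + (norm (p - a))\<^sup>2 + 2 * inner (q - p) (p - a)"
    unfolding power2_norm_eq_inner by (simp add: algebra_simps inner_commute)
  with assms show ?thesis by simp
qed

text \<open>The obtuse angle gives both minimality of $p$ and, since it makes $\|q-p\|^2$ a lower bound
  for the excess of $\|q-a\|^2$ over $\|p-a\|^2$, uniqueness; so a variational inequality identifies the projection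
  even onto sets not known to be closed or convex.\<close>

lemma metric_projection_eqI:
  fixes a p :: "'a::real_inner"
  assumes "p \<in> D" and "\<And>q. q \<in> D \<Longrightarrow> inner (q - p) (p - a) \<ge> 0"
  shows "metric_projection D a = p"
  unfolding metric_projection_def
proof (rule the_equality)
  have ineq: "(norm (q - p))\<^sup>2 + (dist a p)\<^sup>2 \<le> (dist a q)\<^sup>2" if "q \<in> D" for q
    using obtuse_angle_norm_sq_le[OF assms(2)[OF that]] by (simp add: dist_norm norm_minus_commute)
  show "p \<in> D \<and> (\<forall>q\<in>D. dist a p \<le> dist a q)"
  proof (intro conjI ballI assms(1))
    fix q assume "q \<in> D"
    have "0 \<le> (norm (q - p))\<^sup>2" by simp
    with ineq[OF \<open>q \<in> D\<close>] have "(dist a p)\<^sup>2 \<le> (dist a q)\<^sup>2" by linarith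
    then show "dist a p \<le> dist a q" by (rule power2_le_imp_le) simp
  qed
  fix r assume r: "r \<in> D \<and> (\<forall>q\<in>D. dist a r \<le> dist a q)"
  then have "(dist a r)\<^sup>2 \<le> (dist a p)\<^sup>2" using assms(1) by (intro power_mono) auto
  with ineq[of r] r have "(norm (r - p))\<^sup>2 \<le> 0" by linarith
  then show "r = p" by simp
qed

text \<open>A nearest point of a convex set sees the whole set at an obtuse angle: otherwise moving a
  little towards $q$ would decrease the distance to $a$.\<close>

lemma nearest_point_variational:
  fixes a p q :: "'a::real_inner"
  assumes "convex D" "p \<in> D" "q \<in> D" and near: "\<And>r. r \<in> D \<Longrightarrow> dist a p \<le> dist a r"
  shows "inner (q - p) (p - a) \<ge> 0"
proof (rule ccontr)
  assume "\<not> ?thesis"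
  then have neg: "inner (p - a) (q - p) < 0" by (simp add: inner_commute)
  define N where "N = (norm (q - p))\<^sup>2"
  have "N > 0" using neg unfolding N_def by auto
  \<comment> \<open>the step at which the squared distance to $a$ along the line is least, cut off so as to
    stay on the segment from $p$ to $q$\<close>
  define s where "s = min 1 (- inner (p - a) (q - p) / N)"
  have s: "0 < s" "s \<le> 1" and sN: "s * N \<le> - inner (p - a) (q - p)"
    using neg \<open>N > 0\<close> unfolding s_def by (auto simp: min_def field_simps)
  have "p + s *\<^sub>R (q - p) = (1 - s) *\<^sub>R p + s *\<^sub>R q" by (simp add: algebra_simps)
  then have "p + s *\<^sub>R (q - p) \<in> D"
    using assms(1-3) s by (simp add: convexD_alt)
  from near[OF this] have "(norm (p - a))\<^sup>2 \<le> (norm (p - a + s *\<^sub>R (q - p)))\<^sup>2"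
    by (intro power_mono) (simp_all add: dist_norm norm_minus_commute algebra_simps)
  also have "\<dots> = (norm (p - a))\<^sup>2 + s * (2 * inner (p - a) (q - p) + s * N)"
    unfolding N_def power2_norm_eq_inner by (simp add: inner_commute algebra_simps)
  finally have "0 \<le> s * (2 * inner (p - a) (q - p) + s * N)" by simp
  then have "0 \<le> 2 * inner (p - a) (q - p) + s * N" using s(1) by (simp add: zero_le_mult_iff)
  with sN neg show False by linarith
qed

text \<open>Minimizing sequences are Cauchy by the parallelogram law, because midpoints of a convex set
  are at least at the minimal distance from $a$.\<close>

lemma nearest_point_exists:
  fixes D :: "'a::{real_inner, complete_space} set"
  assumes "closed D" "convex D" "D \<noteq> {}"
  shows "\<exists>p\<in>D. \<forall>r\<in>D. dist a p \<le> dist a r"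
proof -
  define d where "d = infdist a D"
  have d0: "d \<ge> 0" unfolding d_def by (rule infdist_nonneg)
  have dle: "d \<le> dist a r" if "r \<in> D" for r unfolding d_def by (rule infdist_le[OF that])
  have "\<exists>q\<in>D. (dist a q)\<^sup>2 < d\<^sup>2 + 1 / Suc n" for n
  proof -
    have "d < sqrt (d\<^sup>2 + 1 / Suc n)" using d0 by (intro real_less_rsqrt) simp
    then obtain q where "q \<in> D" "dist a q < sqrt (d\<^sup>2 + 1 / Suc n)"
      unfolding d_def using assms(3) by (auto simp: infdist_def cInf_less_iff)
    moreover have "0 \<le> d\<^sup>2 + 1 / Suc n" by simp
    ultimately show ?thesis
      by (metis real_sqrt_less_iff real_sqrt_abs abs_of_nonneg zero_le_dist)
  qed
  then obtain q where q: "\<And>n. q n \<in> D" "\<And>n. (dist a (q n))\<^sup>2 < d\<^sup>2 + 1 / Suc n" by metis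
  have mid: "(norm (q m - q n))\<^sup>2 \<le> 2 / Suc m + 2 / Suc n" for m n
  proof -
    have "(1 - 1/2) *\<^sub>R q m + (1/2) *\<^sub>R q n \<in> D"
      using q(1) assms(2) by (intro convexD_alt) auto
    from dle[OF this] have "d\<^sup>2 \<le> (norm (a - ((1/2) *\<^sub>R q m + (1/2) *\<^sub>R q n)))\<^sup>2"
      using d0 by (intro power_mono) (simp_all add: dist_norm)
    moreover have "(norm (q m - q n))\<^sup>2 = 2 * (norm (a - q m))\<^sup>2 + 2 * (norm (a - q n))\<^sup>2
        - 4 * (norm (a - ((1/2) *\<^sub>R q m + (1/2) *\<^sub>R q n)))\<^sup>2"
      unfolding power2_norm_eq_inner
      by (simp add: inner_commute algebra_simps)
    ultimately show ?thesis using q(2)[of m] q(2)[of n] by (simp add: dist_norm)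
  qed
  have "Cauchy q"
  proof (rule metric_CauchyI)
    fix e :: real assume "e > 0"
    then obtain M where M: "inverse (real (Suc M)) < e\<^sup>2 / 4"
      using reals_Archimedean[of "e\<^sup>2 / 4"] by auto
    have small: "2 / Suc k < e\<^sup>2 / 2" if "k \<ge> M" for k
    proof -
      have "inverse (real (Suc k)) \<le> inverse (real (Suc M))" using that by simp
      moreover have "2 / Suc k = 2 * inverse (real (Suc k))" by (simp only: divide_inverse)
      ultimately show ?thesis using M by linarith
    qed
    have "dist (q m) (q n) < e" if "m \<ge> M" "n \<ge> M" for m n
    proof -
      have "(dist (q m) (q n))\<^sup>2 < e\<^sup>2"
        using mid[of m n] small[OF that(1)] small[OF that(2)] by (simp add: dist_norm)
      then show ?thesis by (rule power2_less_imp_less) (use \<open>e > 0\<close> in simp)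
    qed
    then show "\<exists>M. \<forall>m\<ge>M. \<forall>n\<ge>M. dist (q m) (q n) < e" by blast
  qed
  then obtain p where p: "q \<longlonglongrightarrow> p" using Cauchy_convergent convergent_def by blast
  have "p \<in> D" using assms(1) p q(1) by (metis closed_sequentially)
  have "(dist a p)\<^sup>2 \<le> d\<^sup>2"
  proof (rule LIMSEQ_le)
    show "(\<lambda>n. (dist a (q n))\<^sup>2) \<longlonglongrightarrow> (dist a p)\<^sup>2" by (intro tendsto_intros p)
    show "(\<lambda>n. d\<^sup>2 + 1 / Suc n) \<longlonglongrightarrow> d\<^sup>2"
      using tendsto_add[OF tendsto_const LIMSEQ_inverse_real_of_nat, of "d\<^sup>2"]
      by (simp only: divide_inverse mult_1 add_0_right)
  qed (use q(2) in \<open>auto intro: less_imp_le\<close>)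
  then have "dist a p \<le> d" by (rule power2_le_imp_le) (rule d0)
  with dle \<open>p \<in> D\<close> show ?thesis by (meson order_trans)
qed

lemma metric_projection_characterization:
  fixes D :: "'a::{real_inner, complete_space} set"
  assumes "closed D" "convex D" "D \<noteq> {}"
  shows metric_projection_in: "metric_projection D a \<in> D"
    and metric_projection_variational:
      "q \<in> D \<Longrightarrow> inner (q - metric_projection D a) (metric_projection D a - a) \<ge> 0"
proof -
  obtain p where p: "p \<in> D" "\<And>r. r \<in> D \<Longrightarrow> dist a p \<le> dist a r"
    using nearest_point_exists[OF assms] by blast
  have var: "inner (r - p) (p - a) \<ge> 0" if "r \<in> D" for r
    by (rule nearest_point_variational[OF assms(2) p(1) that p(2)])
  have eq: "metric_projection D a = p" by (rule metric_projection_eqI[OF p(1) var])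
  show "metric_projection D a \<in> D" by (simp add: eq p(1))
  show "q \<in> D \<Longrightarrow> inner (q - metric_projection D a) (metric_projection D a - a) \<ge> 0"
    by (simp add: eq var)
qed

section \<open>Browder's approximants\<close>

lemma nonexpansive_onD:
  "nonexpansive_on C T \<Longrightarrow> a \<in> C \<Longrightarrow> b \<in> C \<Longrightarrow> norm (T a - T b) \<le> norm (a - b)"
  by (simp add: nonexpansive_on_def)

text \<open>By Cauchy--Schwarz, $\langle Ta-Tb, a-b\rangle \le \|a-b\|^2$: the displacement $I-T$ is a
  monotone operator.\<close>

lemma displacement_monotone:
  fixes T :: "'a::real_inner \<Rightarrow> 'a"
  assumes "nonexpansive_on C T" "a \<in> C" "b \<in> C"
  shows "inner ((a - T a) - (b - T b)) (a - b) \<ge> 0"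
proof -
  have "inner (T a - T b) (a - b) \<le> norm (T a - T b) * norm (a - b)" by (rule norm_cauchy_schwarz)
  also have "\<dots> \<le> norm (a - b) * norm (a - b)"
    by (intro mult_right_mono nonexpansive_onD[OF assms]) simp
  also have "\<dots> = inner (a - b) (a - b)" by (simp add: power2_norm_eq_inner flip: power2_eq_square)
  finally show ?thesis by (simp add: algebra_simps)
qed

text \<open>The equation says that $z$ is a fixed point of the contraction
  $v \mapsto \frac1{1+k}u + \frac k{1+k}Tv$.\<close>

lemma browder_approximant_exists:
  fixes C :: "'a::{real_inner, complete_space} set"
  assumes "closed C" "convex C" "T \<in> C \<rightarrow> C" "nonexpansive_on C T" "u \<in> C" "k \<ge> 0"
  shows "\<exists>z\<in>C. u - z = k *\<^sub>R (z - T z)"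
proof -
  define c where "c = k / (1 + k)"
  have c: "0 \<le> c" "c < 1" and ck: "(1 + k) * c = k" "(1 + k) * (1 - c) = 1"
    using assms(6) unfolding c_def by (auto simp: field_simps)
  define f where "f v = (1 - c) *\<^sub>R u + c *\<^sub>R T v" for v
  have "\<exists>!z\<in>C. f z = z"
  proof (rule Banach_fix[of C c f])
    show "complete C" using assms(1) by (simp add: complete_eq_closed)
    show "f ` C \<subseteq> C"
      using assms(2,3,5) c unfolding f_def by (auto intro!: convexD_alt)
    show "\<And>x y. x \<in> C \<Longrightarrow> y \<in> C \<Longrightarrow> dist (f x) (f y) \<le> c * dist x y"
    proof -
      fix x y assume "x \<in> C" "y \<in> C"
      have "f x - f y = c *\<^sub>R (T x - T y)" by (simp add: f_def algebra_simps)
      then have "dist (f x) (f y) = c * norm (T x - T y)" using c by (simp add: dist_norm)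
      also have "\<dots> \<le> c * dist x y"
        using nonexpansive_onD[OF assms(4) \<open>x \<in> C\<close> \<open>y \<in> C\<close>] c(1)
        by (simp add: dist_norm mult_left_mono)
      finally show "dist (f x) (f y) \<le> c * dist x y" .
    qed
  qed (use assms(5) c in auto)
  then obtain z where z: "z \<in> C" "f z = z" by blast
  have "(1 + k) *\<^sub>R z = ((1 + k) * (1 - c)) *\<^sub>R u + ((1 + k) * c) *\<^sub>R T z"
    using arg_cong[OF z(2), of "\<lambda>v. (1 + k) *\<^sub>R v"]
    by (simp add: f_def scaleR_add_right flip: scaleR_scaleR)
  then have "(1 + k) *\<^sub>R z = u + k *\<^sub>R T z" by (simp add: ck)
  then have "u - z = k *\<^sub>R (z - T z)" by (simp add: algebra_simps)
  with z(1) show ?thesis by blast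
qed

text \<open>Multiplying monotonicity at the two approximants by $st$ eliminates $T$ and leaves
  $\langle s(u-z_t) - t(u-z_s),\, z_t-z_s\rangle \ge 0$, whose terms separate into
  $s\|z_t-z_s\|^2 \le (t-s)\langle z_t-z_s, z_s-u\rangle$.\<close>

lemma browder_approximants_obtuse:
  fixes T :: "'a::real_inner \<Rightarrow> 'a"
  assumes "nonexpansive_on C T" "v \<in> C" "w \<in> C" "0 \<le> s" "s < t"
    and "u - v = s *\<^sub>R (v - T v)" and "u - w = t *\<^sub>R (w - T w)"
  shows "inner (w - v) (v - u) \<ge> 0"
proof -
  have "0 \<le> s * t * inner ((w - T w) - (v - T v)) (w - v)"
    using displacement_monotone[OF assms(1,3,2)] assms(4,5) by simp
  also have "\<dots> = inner (s *\<^sub>R (t *\<^sub>R (w - T w)) - t *\<^sub>R (s *\<^sub>R (v - T v))) (w - v)"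
    by (simp add: algebra_simps)
  also have "\<dots> = inner (s *\<^sub>R (u - w) - t *\<^sub>R (u - v)) (w - v)" by (simp add: assms(6,7))
  also have "\<dots> = (t - s) * inner (w - v) (v - u) - s * inner (w - v) (w - v)"
    by (simp add: inner_commute algebra_simps)
  finally have "0 \<le> (t - s) * inner (w - v) (v - u) - s * inner (w - v) (w - v)" .
  moreover have "0 \<le> s * inner (w - v) (w - v)" using assms(4) by simp
  ultimately have "0 \<le> (t - s) * inner (w - v) (v - u)" by linarith
  then show ?thesis using assms(5) by (simp add: zero_le_mult_iff)
qed

lemma browder_approximant_inner_le:
  fixes T :: "'a::real_inner \<Rightarrow> 'a"
  assumes "nonexpansive_on C T" "z \<in> C" "v \<in> C" "0 \<le> k" "u - z = k *\<^sub>R (z - T z)"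
  shows "inner (u - z) (v - z) \<le> k * inner (v - T v) (v - z)"
proof -
  have "inner (z - T z) (v - z) \<le> inner (v - T v) (v - z)"
    using displacement_monotone[OF assms(1,3,2)] by (simp add: inner_diff_left)
  then show ?thesis using assms(4) by (simp add: assms(5) mult_left_mono)
qed

text \<open>The squared distances to $u$ form a bounded increasing real sequence, hence a Cauchy
  sequence, and their differences dominate the squared distances between the points.\<close>

lemma bounded_norm_increments_Cauchy:
  fixes z :: "nat \<Rightarrow> 'a::real_normed_vector"
  assumes incr: "\<And>m n. m < n \<Longrightarrow> (norm (z n - z m))\<^sup>2 + (norm (z m - u))\<^sup>2 \<le> (norm (z n - u))\<^sup>2"
    and bound: "\<And>n. norm (z n - u) \<le> B"
  shows "Cauchy z"
proof (rule metric_CauchyI)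
  define \<phi> where "\<phi> n = (norm (z n - u))\<^sup>2" for n
  have sq: "(dist (z m) (z n))\<^sup>2 \<le> \<bar>\<phi> m - \<phi> n\<bar>" for m n
    using incr[of m n] incr[of n m]
    by (cases m n rule: linorder_cases) (auto simp: \<phi>_def dist_norm norm_minus_commute)
  have "incseq \<phi>"
  proof (rule incseq_SucI)
    show "\<phi> n \<le> \<phi> (Suc n)" for n
      using incr[of n "Suc n"] zero_le_power2[of "norm (z (Suc n) - z n)"] unfolding \<phi>_def by linarith
  qed
  moreover have "\<phi> n \<le> B\<^sup>2" for n
    unfolding \<phi>_def by (intro power_mono bound) simp
  ultimately have "convergent \<phi>" by (metis incseq_convergent convergent_def)
  then have Cauchy: "Cauchy \<phi>" by (rule convergent_Cauchy)
  fix e :: real assume "e > 0"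
  then obtain M where M: "\<And>m n. m \<ge> M \<Longrightarrow> n \<ge> M \<Longrightarrow> dist (\<phi> m) (\<phi> n) < e\<^sup>2"
    using metric_CauchyD[OF Cauchy, of "e\<^sup>2"] by auto
  have "dist (z m) (z n) < e" if "m \<ge> M" "n \<ge> M" for m n
  proof -
    have "(dist (z m) (z n))\<^sup>2 < e\<^sup>2"
      using sq[of m n] M[OF that] by (simp add: dist_real_def)
    then show ?thesis by (rule power2_less_imp_less) (use \<open>e > 0\<close> in simp)
  qed
  then show "\<exists>M. \<forall>m\<ge>M. \<forall>n\<ge>M. dist (z m) (z n) < e" by blast
qed

text \<open>The limit is a fixed point because $z_k - Tz_k = (u-z_k)/k$ with bounded numerator; its
  variational inequality is the limit of that of the $z_k$, which holds since $I-T$ vanishes at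
  every fixed point.\<close>

lemma browder_convergence:
  fixes C :: "'a::{real_inner, complete_space} set"
  assumes "closed C" "convex C" "T \<in> C \<rightarrow> C" "nonexpansive_on C T" "u \<in> C"
    and "fixed_points C T \<noteq> {}"
  obtains p z where "p \<in> fixed_points C T" "z \<longlonglongrightarrow> p"
    "\<And>n. z n \<in> C" "\<And>n. u - z n = real n *\<^sub>R (z n - T (z n))"
    "\<And>n q. q \<in> fixed_points C T \<Longrightarrow> norm (z n - u) \<le> norm (q - u)"
    "\<And>q. q \<in> fixed_points C T \<Longrightarrow> inner (q - p) (p - u) \<ge> 0"
proof -
  \<comment> \<open>the value $n=0$ is harmless: there the equation just says that $z=u$\<close>
  have "\<exists>z\<in>C. u - z = real n *\<^sub>R (z - T z)" for n
    by (rule browder_approximant_exists[OF assms(1-5)]) simp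
  then obtain z where z: "\<And>n. z n \<in> C" "\<And>n. u - z n = real n *\<^sub>R (z n - T (z n))" by metis
  have var: "inner (q - z n) (z n - u) \<ge> 0" if "q \<in> fixed_points C T" for n q
  proof -
    have "q \<in> C" "T q = q" using that by (auto simp: fixed_points_def)
    then have "inner (u - z n) (q - z n) \<le> 0"
      using browder_approximant_inner_le[OF assms(4) z(1) _ _ z(2), of q n] by simp
    then show ?thesis by (simp add: inner_commute algebra_simps)
  qed
  have bound: "norm (z n - u) \<le> norm (q - u)" if "q \<in> fixed_points C T" for n q
  proof (rule power2_le_imp_le)
    show "(norm (z n - u))\<^sup>2 \<le> (norm (q - u))\<^sup>2"
      using obtuse_angle_norm_sq_le[OF var[OF that, of n]] zero_le_power2[of "norm (q - z n)"]
      by linarith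
  qed simp
  obtain q where q: "q \<in> fixed_points C T" using assms(6) by blast
  have "Cauchy z"
  proof (rule bounded_norm_increments_Cauchy[where u = u and B = "norm (q - u)"])
    fix m n :: nat assume "m < n"
    then show "(norm (z n - z m))\<^sup>2 + (norm (z m - u))\<^sup>2 \<le> (norm (z n - u))\<^sup>2"
      by (intro obtuse_angle_norm_sq_le
            browder_approximants_obtuse[OF assms(4) z(1) z(1) _ _ z(2) z(2)]) auto
  qed (rule bound[OF q])
  then obtain p where p: "z \<longlonglongrightarrow> p" using Cauchy_convergent convergent_def by blast
  have "p \<in> C" using assms(1) p z(1) by (metis closed_sequentially)
  have "(\<lambda>n. z n - T (z n)) \<longlonglongrightarrow> 0"
  proof (rule Lim_null_comparison)
    show "\<forall>\<^sub>F n in sequentially. norm (z n - T (z n)) \<le> norm (q - u) / real n"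
    proof (rule eventually_sequentiallyI[of 1])
      fix n :: nat assume "1 \<le> n"
      have "real n * norm (z n - T (z n)) = norm (u - z n)" by (simp add: z(2)[of n])
      also have "\<dots> \<le> norm (q - u)" using bound[OF q, of n] by (simp add: norm_minus_commute)
      finally show "norm (z n - T (z n)) \<le> norm (q - u) / real n"
        using \<open>1 \<le> n\<close> by (simp add: field_simps)
    qed
    show "(\<lambda>n. norm (q - u) / real n) \<longlonglongrightarrow> 0" by (rule lim_const_over_n)
  qed
  moreover have "(\<lambda>n. T (z n)) \<longlonglongrightarrow> T p"
  proof (rule Lim_transform_bound[where g = "\<lambda>n. z n - p", THEN LIM_zero_cancel])
    show "\<forall>\<^sub>F n in sequentially. norm (T (z n) - T p) \<le> norm (z n - p)"
      using nonexpansive_onD[OF assms(4) z(1) \<open>p \<in> C\<close>] by simp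
    show "(\<lambda>n. z n - p) \<longlonglongrightarrow> 0" using p by (rule LIM_zero)
  qed
  ultimately have "p - T p = 0" using LIMSEQ_unique[OF tendsto_diff[OF p]] by blast
  with \<open>p \<in> C\<close> have "p \<in> fixed_points C T" by (simp add: fixed_points_def)
  moreover have "inner (r - p) (p - u) \<ge> 0" if "r \<in> fixed_points C T" for r
  proof (rule LIMSEQ_le_const)
    show "(\<lambda>n. inner (r - z n) (z n - u)) \<longlonglongrightarrow> inner (r - p) (p - u)" by (intro tendsto_intros p)
  qed (use var[OF that] in auto)
  ultimately show thesis using that p z bound by blast
qed

section \<open>Approximate fixed point sequences\<close>

text \<open>This argument takes the place of demiclosedness and weak compactness. Because $\|x_n-u\|\le\|p-u\|$,
  the square $\|x_n-p\|^2$ is at most $2\langle u-p, x_n-p\rangle$, and replacing $p$ by $z_k$ in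
  that product costs a multiple of $\|z_k-p\|$, uniformly in $n$.\<close>

lemma approximate_fixed_points_tendsto_projection:
  fixes C :: "'a::{real_inner, complete_space} set"
  assumes "closed C" "convex C" "T \<in> C \<rightarrow> C" "nonexpansive_on C T" "u \<in> C"
    and "fixed_points C T \<noteq> {}"
    and x: "\<And>n. x n \<in> C" and afp: "(\<lambda>n. x n - T (x n)) \<longlonglongrightarrow> 0"
    and near: "\<And>n q. q \<in> fixed_points C T \<Longrightarrow> norm (x n - u) \<le> norm (q - u)"
  shows "x \<longlonglongrightarrow> metric_projection (fixed_points C T) u"
proof -
  obtain p z where p: "p \<in> fixed_points C T" "z \<longlonglongrightarrow> p"
    and z: "\<And>n. z n \<in> C" "\<And>n. u - z n = real n *\<^sub>R (z n - T (z n))"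
    and zB: "\<And>n q. q \<in> fixed_points C T \<Longrightarrow> norm (z n - u) \<le> norm (q - u)"
    and var: "\<And>q. q \<in> fixed_points C T \<Longrightarrow> inner (q - p) (p - u) \<ge> 0"
    using browder_convergence[OF assms(1-6)] by blast
  define B where "B = norm (p - u)"
  have key: "(norm (x n - p))\<^sup>2 \<le> 4 * B * real k * norm (x n - T (x n)) + 6 * B * norm (z k - p)"
    for n k
  proof -
    have xu: "norm (x n - u) \<le> B" and zu: "norm (z k - u) \<le> B"
      unfolding B_def using near zB p(1) by auto
    have xz: "norm (x n - z k) \<le> 2 * B"
      using norm_triangle_ineq4[of "x n - u" "z k - u"] xu zu by simp
    have xp: "norm (x n - p) \<le> 2 * B"
      using norm_triangle_ineq4[of "x n - u" "p - u"] xu by (simp add: B_def)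
    have "inner (x n - T (x n)) (x n - z k) \<le> norm (x n - T (x n)) * norm (x n - z k)"
      by (rule norm_cauchy_schwarz)
    also have "\<dots> \<le> norm (x n - T (x n)) * (2 * B)" by (intro mult_left_mono xz) simp
    finally have "real k * inner (x n - T (x n)) (x n - z k)
        \<le> real k * (norm (x n - T (x n)) * (2 * B))" by (intro mult_left_mono) simp_all
    with browder_approximant_inner_le[OF assms(4) z(1) x _ z(2), of k n]
    have 1: "inner (u - z k) (x n - z k) \<le> 2 * B * real k * norm (x n - T (x n))"
      by (simp add: mult_ac)
    have "inner (u - z k) (z k - p) \<le> norm (u - z k) * norm (z k - p)"
      by (rule norm_cauchy_schwarz)
    also have "\<dots> \<le> B * norm (z k - p)"
      using zu by (intro mult_right_mono) (simp_all add: norm_minus_commute)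
    finally have 2: "inner (u - z k) (z k - p) \<le> B * norm (z k - p)" .
    have "inner (z k - p) (x n - p) \<le> norm (z k - p) * norm (x n - p)"
      by (rule norm_cauchy_schwarz)
    also have "\<dots> \<le> norm (z k - p) * (2 * B)" by (intro mult_left_mono xp) simp
    finally have 3: "inner (z k - p) (x n - p) \<le> 2 * B * norm (z k - p)" by (simp add: mult_ac)
    have "inner (u - p) (x n - p)
        = inner (u - z k) (x n - z k) + inner (u - z k) (z k - p) + inner (z k - p) (x n - p)"
      by (simp add: inner_commute algebra_simps)
    with 1 2 3
    have 4: "inner (u - p) (x n - p) \<le> 2 * B * real k * norm (x n - T (x n)) + 3 * B * norm (z k - p)"
      by linarith
    have "(norm (x n - p))\<^sup>2 = (norm (x n - u))\<^sup>2 - B\<^sup>2 + 2 * inner (u - p) (x n - p)"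
      unfolding B_def power2_norm_eq_inner by (simp add: inner_commute algebra_simps)
    also have "\<dots> \<le> 2 * inner (u - p) (x n - p)" using power_mono[OF xu, of 2] by simp
    finally show ?thesis using 4 by simp
  qed
  have "x \<longlonglongrightarrow> p"
  proof (rule metric_LIMSEQ_I)
    fix e :: real assume "e > 0"
    then have e: "e\<^sup>2 / 2 > 0" by simp
    have "(\<lambda>k. 6 * B * norm (z k - p)) \<longlonglongrightarrow> 6 * B * norm (p - p)"
      by (intro tendsto_intros p(2))
    then have "\<forall>\<^sub>F k in sequentially. 6 * B * norm (z k - p) < e\<^sup>2 / 2"
      by (rule order_tendstoD(2)) (use e in simp)
    then obtain k where k: "6 * B * norm (z k - p) < e\<^sup>2 / 2"
      using eventually_happens by force
    have "(\<lambda>n. 4 * B * real k * norm (x n - T (x n))) \<longlonglongrightarrow> 4 * B * real k * norm (0::'a)"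
      by (intro tendsto_intros afp)
    then have "\<forall>\<^sub>F n in sequentially. 4 * B * real k * norm (x n - T (x n)) < e\<^sup>2 / 2"
      by (rule order_tendstoD(2)) (use e in simp)
    then obtain N where N: "\<And>n. n \<ge> N \<Longrightarrow> 4 * B * real k * norm (x n - T (x n)) < e\<^sup>2 / 2"
      unfolding eventually_sequentially by blast
    have "dist (x n) p < e" if "n \<ge> N" for n
    proof -
      have "(dist (x n) p)\<^sup>2 < e\<^sup>2"
        using key[of n k] k N[OF that] by (simp add: dist_norm)
      then show ?thesis by (rule power2_less_imp_less) (use \<open>e > 0\<close> in simp)
    qed
    then show "\<exists>N. \<forall>n\<ge>N. dist (x n) p < e" by blast
  qed
  moreover have "metric_projection (fixed_points C T) u = p"
    by (rule metric_projection_eqI[OF p(1) var])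
  ultimately show ?thesis by simp
qed

section \<open>Strong convergence of the hybrid iteration\<close>

theorem theorem7p5:
  fixes C :: "'a::{real_inner, complete_space} set"
    and T :: "'a \<Rightarrow> 'a"
    and \<alpha> :: "nat \<Rightarrow> real"
    and x y :: "nat \<Rightarrow> 'a"
    and Cn Cstar Q :: "nat \<Rightarrow> 'a set"
  assumes "C \<noteq> {}" and "closed C" and "convex C"
    and "T \<in> C \<rightarrow> C" and "nonexpansive_on C T"
    and "fixed_points C T \<noteq> {}"
    and "\<And>n. \<alpha> n \<in> {0<..<1}" and "\<alpha> \<longlonglongrightarrow> 1"
    and "x 0 \<in> C"
    and "\<And>n. y n = (1 - \<alpha> n) *\<^sub>R x 0 + \<alpha> n *\<^sub>R T (x n)"
    and "\<And>n. Cn n = {z \<in> C. (norm (z - y n))\<^sup>2 \<le> (norm (z - x n))\<^sup>2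
                 + (1 - \<alpha> n) * ((norm (x 0))\<^sup>2 + 2 * inner (x n - x 0) z)}"
    and "\<And>n. Q n = {z \<in> C. inner (z - x n) (x n - x 0) \<ge> 0}"
    and "\<And>n. closed (Cstar n)" and "\<And>n. convex (Cstar n)"
    and "\<And>n. fixed_points C T \<subseteq> Cstar n" and "\<And>n. Cstar n \<subseteq> Cn n"
    and "\<And>n. x (Suc n) = metric_projection (Cstar n \<inter> Q n) (x 0)"
  shows "x \<longlonglongrightarrow> metric_projection (fixed_points C T) (x 0)"
proof -
  note closedC = assms(2) and convexC = assms(3) and TC = assms(4) and ne = assms(5)
    and Fne = assms(6) and \<alpha>01 = assms(7) and \<alpha>1 = assms(8) and x0 = assms(9) and y = assms(10)
    and Cn = assms(11) and Q = assms(12) and Fsub = assms(15) and Csub = assms(16) and step = assms(17)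
  let ?F = "fixed_points C T"
  define D where "D n = Cstar n \<inter> Q n" for n
  have "Q n = C \<inter> {z. inner (x n - x 0) z \<ge> inner (x n - x 0) (x n)}" for n
    by (auto simp: Q inner_diff inner_commute)
  then have D: "closed (D n)" "convex (D n)" for n
    unfolding D_def using closedC convexC assms(13,14)
    by (auto intro!: closed_Int convex_Int closed_halfspace_ge convex_halfspace_ge)
  have FD: "?F \<subseteq> D n" for n
  proof (induction n)
    case 0
    \<comment> \<open>at the start the half-space degenerates: its normal vector is $x_0-x_0$\<close>
    show ?case using Fsub[of 0] by (auto simp: D_def Q fixed_points_def)
  next
    case (Suc n)
    have "q \<in> Q (Suc n)" if "q \<in> ?F" for q
      using metric_projection_variational[OF D(1,2), of n q "x 0"] Suc that
      by (auto simp: Q step D_def fixed_points_def)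
    with Fsub[of "Suc n"] show ?case by (auto simp: D_def)
  qed
  have Dne: "D n \<noteq> {}" for n using FD Fne by blast
  have xD: "x (Suc n) \<in> D n" for n
    using metric_projection_in[OF D Dne, of n "x 0"] by (simp add: step D_def)
  have xC: "x n \<in> C" for n
  proof (cases n)
    case (Suc m) then show ?thesis using xD[of m] by (auto simp: D_def Q)
  qed (use x0 in simp)
  have near: "norm (x n - x 0) \<le> norm (q - x 0)" if "q \<in> ?F" for n q
  proof (rule power2_le_imp_le)
    have "inner (q - x n) (x n - x 0) \<ge> 0" using FD[of n] that by (auto simp: D_def Q)
    from obtuse_angle_norm_sq_le[OF this] show "(norm (x n - x 0))\<^sup>2 \<le> (norm (q - x 0))\<^sup>2"
      using zero_le_power2[of "norm (q - x n)"] by linarith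
  qed simp
  obtain q where q: "q \<in> ?F" using Fne by blast
  define B where "B = norm (q - x 0)"
  have xB: "norm (x n - x 0) \<le> B" for n using near[OF q] by (simp add: B_def)
  have B0: "B \<ge> 0" by (simp add: B_def)

  have incr: "(norm (x (Suc n) - x n))\<^sup>2 + (norm (x n - x 0))\<^sup>2 \<le> (norm (x (Suc n) - x 0))\<^sup>2" for n
    using xD[of n] by (intro obtuse_angle_norm_sq_le) (auto simp: D_def Q)
  define \<phi> where "\<phi> n = (norm (x n - x 0))\<^sup>2" for n
  have "incseq \<phi>"
  proof (rule incseq_SucI)
    show "\<phi> n \<le> \<phi> (Suc n)" for n
      using incr[of n] zero_le_power2[of "norm (x (Suc n) - x n)"] unfolding \<phi>_def by linarith
  qed
  moreover have "\<phi> n \<le> B\<^sup>2" for n unfolding \<phi>_def by (intro power_mono xB) simp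
  ultimately obtain L where L: "\<phi> \<longlonglongrightarrow> L" by (metis incseq_convergent)
  have dx2: "(\<lambda>n. (norm (x (Suc n) - x n))\<^sup>2) \<longlonglongrightarrow> 0"
  proof (rule Lim_null_comparison)
    show "\<forall>\<^sub>F n in sequentially. norm ((norm (x (Suc n) - x n))\<^sup>2) \<le> \<phi> (Suc n) - \<phi> n"
      by (rule always_eventually) (use incr in \<open>auto simp: \<phi>_def algebra_simps\<close>)
    show "(\<lambda>n. \<phi> (Suc n) - \<phi> n) \<longlonglongrightarrow> 0"
      using tendsto_diff[OF LIMSEQ_Suc[OF L] L] by simp
  qed
  have dx: "(\<lambda>n. norm (x (Suc n) - x n)) \<longlonglongrightarrow> 0"
    using tendsto_real_sqrt[OF dx2] by simp

  have \<alpha>0: "(\<lambda>n. 1 - \<alpha> n) \<longlonglongrightarrow> 0" using tendsto_diff[OF tendsto_const \<alpha>1, of 1] by simp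
  define K where "K = (norm (x 0))\<^sup>2 + 2 * (B * (B + norm (x 0)))"
  have dy2: "(\<lambda>n. (norm (x (Suc n) - y n))\<^sup>2) \<longlonglongrightarrow> 0"
  proof (rule Lim_null_comparison)
    show "\<forall>\<^sub>F n in sequentially. norm ((norm (x (Suc n) - y n))\<^sup>2)
        \<le> (norm (x (Suc n) - x n))\<^sup>2 + (1 - \<alpha> n) * K"
    proof (rule always_eventually, rule allI)
      fix n
      have "x (Suc n) \<in> Cn n" using xD[of n] Csub[of n] by (auto simp: D_def)
      then have *: "(norm (x (Suc n) - y n))\<^sup>2 \<le> (norm (x (Suc n) - x n))\<^sup>2
          + (1 - \<alpha> n) * ((norm (x 0))\<^sup>2 + 2 * inner (x n - x 0) (x (Suc n)))"
        by (simp add: Cn)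
      have "inner (x n - x 0) (x (Suc n)) \<le> norm (x n - x 0) * norm (x (Suc n))"
        by (rule norm_cauchy_schwarz)
      also have "\<dots> \<le> B * (B + norm (x 0))"
        using xB[of n] xB[of "Suc n"] norm_triangle_ineq[of "x (Suc n) - x 0" "x 0"] B0
        by (intro mult_mono) auto
      finally have "(1 - \<alpha> n) * ((norm (x 0))\<^sup>2 + 2 * inner (x n - x 0) (x (Suc n))) \<le> (1 - \<alpha> n) * K"
        unfolding K_def using \<alpha>01[of n] by (intro mult_left_mono) auto
      with * show "norm ((norm (x (Suc n) - y n))\<^sup>2) \<le> (norm (x (Suc n) - x n))\<^sup>2 + (1 - \<alpha> n) * K"
        by simp
    qed
    show "(\<lambda>n. (norm (x (Suc n) - x n))\<^sup>2 + (1 - \<alpha> n) * K) \<longlonglongrightarrow> 0"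
      using tendsto_add[OF dx2 tendsto_mult[OF \<alpha>0 tendsto_const, of K]] by simp
  qed
  have dy: "(\<lambda>n. norm (x (Suc n) - y n)) \<longlonglongrightarrow> 0"
    using tendsto_real_sqrt[OF dy2] by simp

  have "(\<lambda>n. x n - T (x n)) \<longlonglongrightarrow> 0"
  proof (rule Lim_null_comparison)
    show "\<forall>\<^sub>F n in sequentially. norm (x n - T (x n))
        \<le> norm (x (Suc n) - x n) + norm (x (Suc n) - y n) + (1 - \<alpha> n) * (3 * B)"
    proof (rule always_eventually, rule allI)
      fix n
      have "norm (T (x n) - q) \<le> norm (x n - q)"
        using nonexpansive_onD[OF ne xC, of q n] q by (auto simp: fixed_points_def)
      also have "\<dots> \<le> 2 * B"
        using norm_triangle_ineq4[of "x n - x 0" "q - x 0"] xB[of n] by (simp add: B_def)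
      finally have "norm (x 0 - T (x n)) \<le> 3 * B"
        using norm_triangle_ineq4[of "x 0 - q" "T (x n) - q"]
        by (simp add: B_def norm_minus_commute)
      moreover have "y n - T (x n) = (1 - \<alpha> n) *\<^sub>R (x 0 - T (x n))"
        by (simp add: y algebra_simps)
      ultimately have "norm (y n - T (x n)) \<le> (1 - \<alpha> n) * (3 * B)"
        using \<alpha>01[of n] by (simp add: mult_left_mono)
      moreover have "norm (x n - T (x n))
          \<le> norm (x n - x (Suc n)) + norm (x (Suc n) - y n) + norm (y n - T (x n))"
        by norm
      ultimately show "norm (x n - T (x n))
          \<le> norm (x (Suc n) - x n) + norm (x (Suc n) - y n) + (1 - \<alpha> n) * (3 * B)"
        by (simp add: norm_minus_commute)
    qed
    show "(\<lambda>n. norm (x (Suc n) - x n) + norm (x (Suc n) - y n) + (1 - \<alpha> n) * (3 * B)) \<longlonglongrightarrow> 0"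
      using tendsto_add[OF tendsto_add[OF dx dy] tendsto_mult[OF \<alpha>0 tendsto_const, of "3 * B"]]
      by simp
  qed
  from approximate_fixed_points_tendsto_projection[OF closedC convexC TC ne x0 Fne xC this near]
  show ?thesis .
qed

end
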